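(* Let $n\ge 3$ and let $A=(a_{ij})\in\mathbb{C}^{n\times n}$ be irreducible with $A\in DE_n$. Then $\rho(H_{FGS})<1$ (i.e., the sequence $\{x^{(i)}\}$ generated by the FGS scheme converges to the unique solution of $Ax=b$ for any choice of the initial guess $x^{(0)}$) if and only if $D_A^{-1}A\notin \mathscr{U}^{\psi}_n$ for every $\psi\in\mathbb{R}$.
   Context: $DE_n$ is the set of $n\times n$ complex matrices that are diagonally equipotent by row: $|a_{ii}|=\sum_{j\ne i}|a_{ij}|$ for all $i$. For $A$ with all $a_{ii}\neq 0$ (automatic for irreducible $A\in DE_n$, $n\ge 2$), write $A=D_A-L_A-U_A$ with $D_A=\mathrm{diag}(a_{11},\dots,a_{nn})$, $L_A$ strictly lower triangular, $U_A$ strictly upper triangular. The forward Gauss-Seidel (FGS) iteration matrix is $H_{FGS}=(D_A-L_A)^{-1}U_A$, and the FGS scheme for $Ax=b$ is $x^{(i+1)}=H_{FGS}x^{(i)}+(D_A-L_A)^{-1}b$, $i=0,1,2,\dots$. $\rho$ denotes the spectral radius. A matrix $(e^{i\psi_{rs}})\in\mathbb{C}^{n\times n}$ ($\psi_{rs}\in\mathbb{R}$, $i=\sqrt{-1}$) is a $\psi$-ray pattern matrix ($\psi\in\mathbb{R}$) if, modulo $2\pi$: (1) $\psi_{rs}+\psi_{sr}\equiv\psi$ for all $r\ne s$; (2) $\psi_{rs}-\psi_{rt}\equiv\psi_{ts}+\pi$ whenever $r<s<t$ or $s<t<r$ or $t<r<s$; (3) $\psi_{rs}-\psi_{rt}\equiv\psi_{ts}-\psi+\pi$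 whenever $r<t<s$ or $t<s<r$ or $s<r<t$; (4) $\psi_{rr}=0$ for all $r$. $\mathscr{U}^{\psi}_n$ is the set of $n\times n$ complex matrices $B=(b_{rs})$ for which there exist $\eta\in\mathbb{R}$ and a $\psi$-ray pattern matrix $(e^{i\psi_{rs}})$ with $b_{rs}=e^{i\eta}|b_{rs}|e^{i\psi_{rs}}$ for all $r,s$. *)

theory Defs
  imports
    "Jordan_Normal_Form.Spectral_Radius"
    "Jordan_Normal_Form.Gauss_Jordan_Elimination"
    "HOL-Combinatorics.Permutations"
    "HOL-Library.Real_Mod"
begin

(* Row and column indices are 0, ..., n - 1 throughout. *)

definition reducible_mat :: "nat \<Rightarrow> complex mat \<Rightarrow> bool" where
  "reducible_mat n A \<longleftrightarrow>
     (\<exists>\<pi> k B C D. \<pi> permutes {..<n} \<and> 0 < k \<and> k < n \<and>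
        B \<in> carrier_mat k k \<and> C \<in> carrier_mat k (n - k) \<and> D \<in> carrier_mat (n - k) (n - k) \<and>
        mat n n (\<lambda>(i, j). A $$ (\<pi> i, \<pi> j)) = four_block_mat B C (0\<^sub>m (n - k) k) D)"

(* Meant for n >= 2; the separate convention for 1 x 1 matrices is not encoded. *)
definition irreducible_mat :: "nat \<Rightarrow> complex mat \<Rightarrow> bool" where
  "irreducible_mat n A \<longleftrightarrow> A \<in> carrier_mat n n \<and> \<not> reducible_mat n A"

definition DE :: "nat \<Rightarrow> complex mat set" where
  "DE n = {A \<in> carrier_mat n n. \<forall>i<n. norm (A $$ (i, i)) = (\<Sum>j\<in>{..<n} - {i}. norm (A $$ (i, j)))}"

(* The splitting is A = D - L - U, hence the minus signs in the triangular parts. *)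

definition D_part :: "complex mat \<Rightarrow> complex mat" where
  "D_part A = mat_diag (dim_row A) (\<lambda>i. A $$ (i, i))"

definition L_part :: "complex mat \<Rightarrow> complex mat" where
  "L_part A = mat (dim_row A) (dim_col A) (\<lambda>(i, j). if j < i then - A $$ (i, j) else 0)"

definition U_part :: "complex mat \<Rightarrow> complex mat" where
  "U_part A = mat (dim_row A) (dim_col A) (\<lambda>(i, j). if i < j then - A $$ (i, j) else 0)"

(* Unspecified for singular matrices. An irreducible A in DE n with n >= 2 has no zero on
   its diagonal, so D_part A and D_part A - L_part A are then invertible. *)
definition inv_mat :: "complex mat \<Rightarrow> complex mat" where
  "inv_mat M = the (mat_inverse M)"

definition H_FGS :: "complex mat \<Rightarrow> complex mat" where
  "H_FGS A = inv_mat (D_part A - L_part A) * U_part A"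

primrec fgs_seq :: "complex mat \<Rightarrow> complex vec \<Rightarrow> complex vec \<Rightarrow> nat \<Rightarrow> complex vec" where
  "fgs_seq A b x0 0 = x0"
| "fgs_seq A b x0 (Suc i) =
     H_FGS A *\<^sub>v fgs_seq A b x0 i + inv_mat (D_part A - L_part A) *\<^sub>v b"

definition vec_tendsto :: "nat \<Rightarrow> (nat \<Rightarrow> complex vec) \<Rightarrow> complex vec \<Rightarrow> bool" where
  "vec_tendsto n X l \<longleftrightarrow> (\<forall>j<n. (\<lambda>i. X i $ j) \<longlonglongrightarrow> l $ j)"

definition fgs_converges :: "nat \<Rightarrow> complex mat \<Rightarrow> complex vec \<Rightarrow> bool" where
  "fgs_converges n A b \<longleftrightarrow>
     (\<exists>x\<in>carrier_vec n. A *\<^sub>v x = b \<and>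
        (\<forall>y\<in>carrier_vec n. A *\<^sub>v y = b \<longrightarrow> y = x) \<and>
        (\<forall>x0\<in>carrier_vec n. vec_tendsto n (fgs_seq A b x0) x))"

definition ray_pattern_angles :: "nat \<Rightarrow> real \<Rightarrow> (nat \<Rightarrow> nat \<Rightarrow> real) \<Rightarrow> bool" where
  "ray_pattern_angles n \<psi> \<theta> \<longleftrightarrow>
     (\<forall>r<n. \<forall>s<n. r \<noteq> s \<longrightarrow> [\<theta> r s + \<theta> s r = \<psi>] (rmod (2 * pi))) \<and>
     (\<forall>r<n. \<forall>s<n. \<forall>t<n. (r < s \<and> s < t) \<or> (s < t \<and> t < r) \<or> (t < r \<and> r < s) \<longrightarrow>
        [\<theta> r s - \<theta> r t = \<theta> t s + pi] (rmod (2 * pi))) \<and>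
     (\<forall>r<n. \<forall>s<n. \<forall>t<n. (r < t \<and> t < s) \<or> (t < s \<and> s < r) \<or> (s < r \<and> r < t) \<longrightarrow>
        [\<theta> r s - \<theta> r t = \<theta> t s - \<psi> + pi] (rmod (2 * pi))) \<and>
     (\<forall>r<n. \<theta> r r = 0)"

definition ray_pattern_mat :: "nat \<Rightarrow> real \<Rightarrow> complex mat \<Rightarrow> bool" where
  "ray_pattern_mat n \<psi> R \<longleftrightarrow>
     (\<exists>\<theta>. ray_pattern_angles n \<psi> \<theta> \<and> R = mat n n (\<lambda>(r, s). cis (\<theta> r s)))"

definition U_class :: "nat \<Rightarrow> real \<Rightarrow> complex mat set" where
  "U_class n \<psi> =
     {B \<in> carrier_mat n n. \<exists>\<eta>::real. \<exists>R. ray_pattern_mat n \<psi> R \<and>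
        (\<forall>r<n. \<forall>s<n. B $$ (r, s) = cis \<eta> * of_real (norm (B $$ (r, s))) * R $$ (r, s))}"

end

theory Submission
  imports Defs
begin

text \<open>An eigenvector \<open>x\<close> of the iteration matrix for an eigenvalue \<open>l\<close> satisfies
  \<open>l (D - L) x = U x\<close>. If \<open>norm l \<ge> 1\<close>, then diagonal equipotence forces equality in the
  triangle inequality in every row where \<open>norm (x $ i)\<close> is maximal, so the maximum propagates along
  the nonzero entries and by irreducibility all entries of \<open>x\<close> have the same modulus. Hence
  \<open>norm l = 1\<close>, and the phases of the entries of \<open>D\<inverse> A\<close> are those of \<open>- x $ i / x $ j\<close> below the
  diagonal and of \<open>- l x $ i / x $ j\<close> above it. These are exactly the ray patterns with
  \<open>l = cis \<psi>\<close>; conversely, such phases yield the eigenvector.\<close>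

section \<open>Irreducibility, the nonzero diagonal and the equality case of the triangle
  inequality\<close>

text \<open>If the complement of \<open>S\<close> is listed first and \<open>S\<close> last,
  closedness is exactly the zero block at the lower left, so a proper \<open>S\<close> would make
  \<open>A\<close> reducible. This is the form in which irreducibility propagates a property along
  nonzero entries.\<close>

lemma irreducible_closed_set_full:
  assumes irr: "irreducible_mat n A"
    and S: "S \<subseteq> {..<n}" "S \<noteq> {}"
    and closed: "\<And>i j. i \<in> S \<Longrightarrow> j < n \<Longrightarrow> j \<notin> S \<Longrightarrow> A $$ (i, j) = 0"
  shows "S = {..<n}"
proof (rule ccontr)
  assume ne: "S \<noteq> {..<n}"
  define k where "k = card ({..<n} - S)"
  have finS: "finite S" using S(1) by (rule finite_subset) simp
  have k0: "0 < k"
    using ne S(1) unfolding k_def by (auto simp: card_gt_0_iff)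
  have kS: "k = n - card S"
    unfolding k_def using S(1) finS by (simp add: card_Diff_subset)
  have kn: "k < n"
    using kS k0 S(2) finS by (simp add: card_gt_0_iff)
  have "card S = n - k"
    using kS card_mono[OF _ S(1)] by simp
  obtain f where f: "bij_betw f {..<k} ({..<n} - S)"
    using finite_same_card_bij[of "{..<k}" "{..<n} - S"] by (auto simp: k_def)
  obtain g where g: "bij_betw g {k..<n} S"
    using finite_same_card_bij[of "{k..<n}" S] finS \<open>card S = n - k\<close> by auto
  \<comment> \<open>The two bijections are glued together; beyond \<open>n\<close> the map is the
    identity, as \<open>permutes\<close> demands.\<close>
  define p where "p = (\<lambda>i. if i < k then f i else if i < n then g i else i)"
  have pf: "bij_betw p {..<k} ({..<n} - S)"
    using f by (rule bij_betw_cong[THEN iffD1, rotated]) (simp add: p_def)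
  have pg: "bij_betw p {k..<n} S"
    using g by (rule bij_betw_cong[THEN iffD1, rotated]) (simp add: p_def)
  have "bij_betw p ({..<k} \<union> {k..<n}) (({..<n} - S) \<union> S)"
    by (rule bij_betw_combine[OF pf pg]) auto
  moreover have "{..<k} \<union> {k..<n} = {..<n}" "({..<n} - S) \<union> S = {..<n}"
    using kn S(1) by auto
  ultimately have "bij_betw p {..<n} {..<n}" by simp
  then have perm: "p permutes {..<n}"
    by (rule bij_imp_permutes) (use kn in \<open>auto simp: p_def\<close>)
  define M where "M = mat n n (\<lambda>(i, j). A $$ (p i, p j))"
  define B where "B = mat k k (\<lambda>(i, j). M $$ (i, j))"
  define C where "C = mat k (n - k) (\<lambda>(i, j). M $$ (i, j + k))"
  define D where "D = mat (n - k) (n - k) (\<lambda>(i, j). M $$ (i + k, j + k))"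
  have zero: "A $$ (p i, p j) = 0" if "k \<le> i" "i < n" "j < k" for i j
    using that closed[of "p i" "p j"] bij_betwE[OF pf] bij_betwE[OF pg] by auto
  have "M = four_block_mat B C (0\<^sub>m (n - k) k) D"
    by (rule eq_matI) (use kn zero in \<open>auto simp: M_def B_def C_def D_def\<close>)
  moreover have "B \<in> carrier_mat k k" "C \<in> carrier_mat k (n - k)"
    "D \<in> carrier_mat (n - k) (n - k)"
    by (simp_all add: B_def C_def D_def)
  ultimately have "reducible_mat n A"
    unfolding reducible_mat_def M_def using perm k0 kn by blast
  with irr show False by (simp add: irreducible_mat_def)
qed

text \<open>Equipotence turns a zero diagonal entry into a zero row. Then \<open>{i}\<close> is
  closed, yet for \<open>n \<ge> 2\<close> it is not the whole index set.\<close>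

lemma irreducible_DE_diag_nonzero:
  assumes n: "n \<ge> 2" and irr: "irreducible_mat n A" and DE: "A \<in> DE n" and i: "i < n"
  shows "A $$ (i, i) \<noteq> 0"
proof
  assume "A $$ (i, i) = 0"
  with DE i have "(\<Sum>j\<in>{..<n} - {i}. norm (A $$ (i, j))) = 0"
    unfolding DE_def by auto
  then have "A $$ (i, j) = 0" if "j < n" "j \<noteq> i" for j
    using that by (simp add: sum_nonneg_eq_0_iff)
  then have "{i} = {..<n}"
    using i by (intro irreducible_closed_set_full[OF irr]) auto
  then have "card {i} = n" by simp
  with n show False by simp
qed

text \<open>Each \<open>Re (w j)\<close> is at most \<open>p j\<close> and the sums agree, so no
  term has slack. Once the real part reaches \<open>p j\<close>, the bound on the norm leaves no
  room for an imaginary part.\<close>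

lemma sum_eq_bound_tight:
  fixes w :: "'a \<Rightarrow> complex"
  assumes fin: "finite J" and le: "\<And>j. j \<in> J \<Longrightarrow> norm (w j) \<le> p j"
    and sum: "(\<Sum>j\<in>J. w j) = of_real (\<Sum>j\<in>J. p j)" and j: "j \<in> J"
  shows "w j = of_real (p j)"
proof -
  have ge: "Re (w k) \<le> p k" if "k \<in> J" for k
    using le[OF that] complex_Re_le_cmod[of "w k"] by linarith
  have "(\<Sum>k\<in>J. p k - Re (w k)) = 0"
    using arg_cong[OF sum, of Re] by (simp add: sum_subtractf)
  then have "Re (w j) = p j"
    using sum_nonneg_eq_0_iff[OF fin, of "\<lambda>k. p k - Re (w k)"] ge j by simp
  moreover from this have "Im (w j) = 0"
    using le[OF j] complex_Re_le_cmod[of "w j"] cmod_eq_Re[of "w j"]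
    by (smt (verit) cmod_power2 power2_less_eq_zero_iff)
  ultimately show ?thesis by (simp add: complex_eq_iff)
qed

section \<open>Inverses and matrix-vector algebra\<close>

lemma inv_mat_inverse:
  assumes M: "M \<in> carrier_mat n n" and det: "det M \<noteq> 0"
  shows "inv_mat M \<in> carrier_mat n n" "M * inv_mat M = 1\<^sub>m n" "inv_mat M * M = 1\<^sub>m n"
proof -
  obtain N where "mat_inverse M = Some N"
    using mat_inverse(1)[OF M, where b = "()"] det_non_zero_imp_unit[OF M det, where b = "()"]
    by (cases "mat_inverse M") auto
  then show "inv_mat M \<in> carrier_mat n n" "M * inv_mat M = 1\<^sub>m n" "inv_mat M * M = 1\<^sub>m n"
    using mat_inverse(2)[OF M] by (auto simp: inv_mat_def)
qed

lemma index_mult_mat_vec_sum: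
  assumes "M \<in> carrier_mat n n" "x \<in> carrier_vec n" "i < n"
  shows "(M *\<^sub>v x) $ i = (\<Sum>j<n. M $$ (i, j) * x $ j)"
  using assms by (auto simp: scalar_prod_def lessThan_atLeast0 intro!: sum.cong)

lemma vec_add_diff_cancel:
  fixes u w :: "'a :: ab_group_add vec"
  assumes "u \<in> carrier_vec n" "w \<in> carrier_vec n"
  shows "u + (w - u) = w"
  using assms by (intro eq_vecI) auto

lemma vec_add_right_commute:
  fixes u v w :: "'a :: ab_semigroup_add vec"
  assumes "u \<in> carrier_vec n" "v \<in> carrier_vec n" "w \<in> carrier_vec n"
  shows "(u + v) + w = (u + w) + v"
  using assms by (intro eq_vecI) (auto simp: ac_simps)

lemma mult_mat_vec_eq_iff_inverse:
  fixes M N :: "'a :: semiring_1 mat"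
  assumes M: "M \<in> carrier_mat n n" and N: "N \<in> carrier_mat n n"
    and MN: "M * N = 1\<^sub>m n" and NM: "N * M = 1\<^sub>m n"
    and x: "x \<in> carrier_vec n" and y: "y \<in> carrier_vec n"
  shows "N *\<^sub>v y = x \<longleftrightarrow> y = M *\<^sub>v x"
proof
  assume Ny: "N *\<^sub>v y = x"
  have "y = (M * N) *\<^sub>v y"
    unfolding MN by (rule one_mult_mat_vec[OF y, symmetric])
  also have "\<dots> = M *\<^sub>v x"
    unfolding assoc_mult_mat_vec[OF M N y] Ny ..
  finally show "y = M *\<^sub>v x" .
next
  assume yM: "y = M *\<^sub>v x"
  have "x = (N * M) *\<^sub>v x"
    unfolding NM by (rule one_mult_mat_vec[OF x, symmetric])
  also have "\<dots> = N *\<^sub>v y"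
    unfolding assoc_mult_mat_vec[OF N M x] yM ..
  finally show "N *\<^sub>v y = x" by (rule sym)
qed

text \<open>Bounds and eigenvector facts are stated for matrix powers, whereas the error of the
  iteration arises by repeated application; this links the two.\<close>

lemma pow_mat_mult_vec_funpow:
  fixes M :: "'a :: comm_ring_1 mat"
  assumes M: "M \<in> carrier_mat n n" and v: "v \<in> carrier_vec n"
  shows "M ^\<^sub>m k *\<^sub>v v = ((*\<^sub>v) M ^^ k) v"
  using v
proof (induction k arbitrary: v)
  case 0
  then show ?case using M by simp
next
  case (Suc k)
  have "M ^\<^sub>m Suc k *\<^sub>v v = M ^\<^sub>m k *\<^sub>v (M *\<^sub>v v)"
    using M Suc.prems by (simp add: assoc_mult_mat_vec[OF pow_carrier_mat[OF M] M])
  also have "\<dots> = ((*\<^sub>v) M ^^ k) (M *\<^sub>v v)"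
    using Suc.IH[of "M *\<^sub>v v"] M Suc.prems by auto
  finally show ?case by (simp add: funpow_swap1)
qed

section \<open>Spectral radius and the decay of powers\<close>

lemma spectral_radius_less_iff:
  assumes M: "M \<in> carrier_mat n n" and n: "n > 0"
  shows "spectral_radius M < r \<longleftrightarrow> (\<forall>k. eigenvalue M k \<longrightarrow> norm k < r)"
  using spectral_radius_mem_max[OF M n] unfolding spectrum_def
  by (metis (mono_tags, lifting) image_iff le_less_trans mem_Collect_eq)

text \<open>An eigenvalue \<open>k\<close> of the scaled matrix yields the eigenvalue
  \<open>k / c\<close> of \<open>M\<close>. With some \<open>c > 1\<close> this uses the gap below 1
  to obtain geometric decay from mere boundedness of powers.\<close>

lemma spectral_radius_smult_less_one:
  assumes M: "M \<in> carrier_mat n n" and n: "n > 0" and c: "c > 0"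
    and less: "c * spectral_radius M < 1"
  shows "spectral_radius (complex_of_real c \<cdot>\<^sub>m M) < 1"
proof -
  have "norm k < 1" if ev: "eigenvalue (complex_of_real c \<cdot>\<^sub>m M) k" for k
  proof -
    from ev obtain v where v: "v \<in> carrier_vec n" "v \<noteq> 0\<^sub>v n"
      and eq: "(complex_of_real c \<cdot>\<^sub>m M) *\<^sub>v v = k \<cdot>\<^sub>v v"
      using M unfolding eigenvalue_def eigenvector_def by auto
    have "M *\<^sub>v v = (k / c) \<cdot>\<^sub>v v"
    proof (rule eq_vecI)
      fix i assume "i < dim_vec ((k / c) \<cdot>\<^sub>v v)"
      then have i: "i < n" using v by simp
      have "c * (M *\<^sub>v v) $ i = k * v $ i"
        using arg_cong[OF eq, of "\<lambda>u. u $ i"] M v i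
        by (simp add: scalar_prod_def sum_distrib_left mult.assoc)
      with c i v show "(M *\<^sub>v v) $ i = ((k / c) \<cdot>\<^sub>v v) $ i"
        by (simp add: field_simps)
    qed (use M v in auto)
    then have "eigenvalue M (k / c)"
      unfolding eigenvalue_def eigenvector_def using M v by auto
    then have "norm (k / c) \<le> spectral_radius M"
      using spectral_radius_mem_max(2)[OF M n] by (auto simp: spectrum_def)
    then show ?thesis
      using less c by (simp add: norm_divide field_simps)
  qed
  then show ?thesis
    using M n by (subst spectral_radius_less_iff[of _ n]) auto
qed

text \<open>The powers of \<open>c M\<close> stay bounded for a suitable \<open>c > 1\<close>, so
  those of \<open>M\<close> decay at least like \<open>(1 / c) ^ k\<close>.\<close>

lemma funpow_mult_mat_vec_tendsto_zero:
  assumes M: "M \<in> carrier_mat n n" and n: "n > 0" and sr: "spectral_radius M < 1"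
    and v: "v \<in> carrier_vec n" and j: "j < n"
  shows "(\<lambda>k. (((*\<^sub>v) M ^^ k) v) $ j) \<longlonglongrightarrow> 0"
proof -
  let ?r = "spectral_radius M"
  have r0: "?r \<ge> 0" using spectral_radius_mem_max(1)[OF M n] by auto
  \<comment> \<open>Since the spectral radius \<open>r\<close> lies in [0, 1), this choice gives
    both \<open>c > 1\<close> and \<open>c * r = 2 r / (1 + r) < 1\<close>.\<close>
  define c where "c = 2 / (1 + ?r)"
  have c: "c > 1" "c * ?r < 1"
    using r0 sr by (auto simp: c_def field_simps)
  define T where "T = complex_of_real c \<cdot>\<^sub>m M"
  have T: "T \<in> carrier_mat n n" using M by (simp add: T_def)
  have "spectral_radius T < 1"
    unfolding T_def by (rule spectral_radius_smult_less_one[OF M n]) (use c in auto)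
  from spectral_radius_jnf_norm_bound_less_1_upper_triangular[OF T this]
  obtain b where b: "\<And>k. norm_bound (T ^\<^sub>m k) b" by blast
  have cr: "((*\<^sub>v) M ^^ k) v \<in> carrier_vec n" for k
    using M v by (induction k) auto
  have pow: "((*\<^sub>v) T ^^ k) v = complex_of_real (c ^ k) \<cdot>\<^sub>v ((*\<^sub>v) M ^^ k) v" for k
  proof (induction k)
    case (Suc k)
    then have "((*\<^sub>v) T ^^ Suc k) v = T *\<^sub>v (complex_of_real (c ^ k) \<cdot>\<^sub>v ((*\<^sub>v) M ^^ k) v)"
      by simp
    also have "\<dots> = complex_of_real (c ^ Suc k) \<cdot>\<^sub>v (M *\<^sub>v ((*\<^sub>v) M ^^ k) v)"
      by (rule eq_vecI)
        (use M cr[of k] in \<open>auto simp: T_def scalar_prod_def sum_distrib_left mult_ac\<close>)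
    finally show ?case by simp
  qed simp
  have bound: "norm ((((*\<^sub>v) M ^^ k) v) $ j) \<le> (\<Sum>i<n. b * norm (v $ i)) * (1 / c) ^ k" for k
  proof -
    have "(((*\<^sub>v) T ^^ k) v) $ j = (\<Sum>i<n. (T ^\<^sub>m k) $$ (j, i) * v $ i)"
      using index_mult_mat_vec_sum[OF pow_carrier_mat[OF T] v j, of k]
      by (simp add: pow_mat_mult_vec_funpow[OF T v])
    also have "norm \<dots> \<le> (\<Sum>i<n. b * norm (v $ i))"
      by (rule sum_norm_le)
        (use b[of k] T j in \<open>auto simp: norm_bound_def norm_mult intro!: mult_right_mono\<close>)
    finally have "c ^ k * norm ((((*\<^sub>v) M ^^ k) v) $ j) \<le> (\<Sum>i<n. b * norm (v $ i))"
      using pow[of k] cr[of k] j c by (simp add: norm_mult norm_power)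
    then show ?thesis using c by (simp add: field_simps)
  qed
  have "(\<lambda>k. (\<Sum>i<n. b * norm (v $ i)) * (1 / c) ^ k) \<longlonglongrightarrow> 0"
    by (intro tendsto_mult_right_zero LIMSEQ_power_zero) (use c in auto)
  then show ?thesis
    by (rule tendsto_0_le[where K = 1])
      (simp add: always_eventually order_trans[OF bound abs_ge_self])
qed

text \<open>Otherwise no term of the sequence has norm below \<open>norm a > 0\<close>.\<close>

lemma norm_less_one_if_scaled_powers_tendsto_zero:
  fixes l a :: complex
  assumes lim: "(\<lambda>k. l ^ k * a) \<longlonglongrightarrow> 0" and a: "a \<noteq> 0"
  shows "norm l < 1"
proof (rule ccontr)
  assume "\<not> norm l < 1"
  then have ge: "norm (l ^ k * a) \<ge> norm a" for k
    by (simp add: norm_mult norm_power mult_le_cancel_right1 one_le_power)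
  have "eventually (\<lambda>k. norm (l ^ k * a) < norm a) sequentially"
    using order_tendstoD(2)[OF tendsto_norm_zero[OF lim], of "norm a"] a by simp
  then show False using ge by (auto simp: eventually_sequentially not_less[symmetric])
qed

section \<open>The Gauss-Seidel splitting and convergence of the iteration\<close>

locale fgs_split =
  fixes n :: nat and A :: "complex mat"
  assumes A: "A \<in> carrier_mat n n" and diag: "\<And>i. i < n \<Longrightarrow> A $$ (i, i) \<noteq> 0"
    and n0: "n > 0"
begin

abbreviation "M \<equiv> D_part A - L_part A"
abbreviation "N \<equiv> inv_mat M"

lemma U_carrier: "U_part A \<in> carrier_mat n n"
  using A by (simp add: U_part_def)

lemma M_carrier: "M \<in> carrier_mat n n"
  using A by (auto simp: L_part_def intro!: minus_carrier_mat)

lemma M_index: "i < n \<Longrightarrow> j < n \<Longrightarrow> M $$ (i, j) = (if j \<le> i then A $$ (i, j) else 0)"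
  using A by (auto simp: D_part_def L_part_def mat_diag_def)

lemma A_eq: "A = M - U_part A"
proof (rule eq_matI)
  fix i j assume "i < dim_row (M - U_part A)" "j < dim_col (M - U_part A)"
  then have "i < n" "j < n" using U_carrier by auto
  then show "A $$ (i, j) = (M - U_part A) $$ (i, j)"
    using A U_carrier M_index[of i j] by (simp add: U_part_def)
qed (use A U_carrier in auto)

lemma det_M: "det M \<noteq> 0"
proof -
  have "det M = prod_list (diag_mat M)"
    by (rule det_lower_triangular[OF _ M_carrier]) (simp add: M_index)
  also have "\<dots> = (\<Prod>i = 0..<n. M $$ (i, i))"
    using M_carrier by (simp only: prod_list_diag_prod carrier_matD)
  also have "\<dots> = (\<Prod>i = 0..<n. A $$ (i, i))"
    by (rule prod.cong) (simp_all add: M_index)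
  finally show ?thesis using diag by simp
qed

lemmas N_carrier = inv_mat_inverse(1)[OF M_carrier det_M]
  and M_N = inv_mat_inverse(2)[OF M_carrier det_M]
  and N_M = inv_mat_inverse(3)[OF M_carrier det_M]

lemma H_carrier: "H_FGS A \<in> carrier_mat n n"
  unfolding H_FGS_def by (rule mult_carrier_mat[OF N_carrier U_carrier])

lemma H_mult_vec: "x \<in> carrier_vec n \<Longrightarrow> H_FGS A *\<^sub>v x = N *\<^sub>v (U_part A *\<^sub>v x)"
  unfolding H_FGS_def by (rule assoc_mult_mat_vec[OF N_carrier U_carrier])

text \<open>Multiplying by \<open>M\<close> removes the inverse and leaves
  \<open>(l M - U) x = 0\<close>. Read row by row, \<open>M\<close> contributes the entries of
  \<open>A\<close> on and below the diagonal, weighted by \<open>l\<close>, and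
  \<open>- U_part A\<close> those above it, with weight 1.\<close>

lemma H_eigen_iff:
  assumes x: "x \<in> carrier_vec n"
  shows "H_FGS A *\<^sub>v x = l \<cdot>\<^sub>v x \<longleftrightarrow>
    (\<forall>i<n. (\<Sum>j<n. (if j \<le> i then l else 1) * A $$ (i, j) * x $ j) = 0)"
proof -
  have "H_FGS A *\<^sub>v x = l \<cdot>\<^sub>v x \<longleftrightarrow> U_part A *\<^sub>v x = M *\<^sub>v (l \<cdot>\<^sub>v x)"
    unfolding H_mult_vec[OF x]
    by (rule mult_mat_vec_eq_iff_inverse[OF M_carrier N_carrier M_N N_M])
      (use x U_carrier in auto)
  also have "\<dots> \<longleftrightarrow> (\<forall>i<n. (U_part A *\<^sub>v x) $ i = (M *\<^sub>v (l \<cdot>\<^sub>v x)) $ i)"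
    using U_carrier M_carrier by (auto simp: vec_eq_iff simp del: index_mult_mat_vec)
  also have "\<dots> \<longleftrightarrow> (\<forall>i<n. (\<Sum>j<n. (if j \<le> i then l else 1) * A $$ (i, j) * x $ j) = 0)"
  proof (intro all_cong1 imp_cong refl)
    fix i assume i: "i < n"
    have "(M *\<^sub>v (l \<cdot>\<^sub>v x)) $ i - (U_part A *\<^sub>v x) $ i
        = (\<Sum>j<n. M $$ (i, j) * (l \<cdot>\<^sub>v x) $ j - U_part A $$ (i, j) * x $ j)"
      using i x
      by (simp add: index_mult_mat_vec_sum[OF M_carrier] index_mult_mat_vec_sum[OF U_carrier]
          sum_subtractf del: index_mult_mat_vec)
    also have "\<dots> = (\<Sum>j<n. (if j \<le> i then l else 1) * A $$ (i, j) * x $ j)"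
      by (rule sum.cong) (use A x i in \<open>auto simp: M_index U_part_def simp del: index_minus_mat\<close>)
    finally show "(U_part A *\<^sub>v x) $ i = (M *\<^sub>v (l \<cdot>\<^sub>v x)) $ i \<longleftrightarrow>
        (\<Sum>j<n. (if j \<le> i then l else 1) * A $$ (i, j) * x $ j) = 0"
      by (metis right_minus_eq)
  qed
  finally show ?thesis .
qed

lemma A_mult_vec:
  assumes x: "x \<in> carrier_vec n"
  shows "A *\<^sub>v x = M *\<^sub>v x - U_part A *\<^sub>v x"
  by (subst A_eq) (rule minus_mult_distrib_mat_vec[OF M_carrier U_carrier x])

lemma solution_fixed:
  assumes x: "x \<in> carrier_vec n" and eq: "A *\<^sub>v x = b"
  shows "x = H_FGS A *\<^sub>v x + N *\<^sub>v b"
proof -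
  have Ux: "U_part A *\<^sub>v x \<in> carrier_vec n" and Mx: "M *\<^sub>v x \<in> carrier_vec n"
    using x U_carrier M_carrier by auto
  have b: "b \<in> carrier_vec n" using eq A x by auto
  have "M *\<^sub>v x = U_part A *\<^sub>v x + b"
    using vec_add_diff_cancel[OF Ux Mx] by (simp add: eq[symmetric] A_mult_vec[OF x])
  moreover have "x = N *\<^sub>v (M *\<^sub>v x)"
    using mult_mat_vec_eq_iff_inverse[OF M_carrier N_carrier M_N N_M x Mx] by simp
  ultimately show ?thesis
    using mult_add_distrib_mat_vec[OF N_carrier Ux b] by (simp add: H_mult_vec[OF x])
qed

text \<open>A solution is a fixed point of the affine iteration, so the contribution of
  \<open>b\<close> cancels and the error evolves linearly under \<open>H_FGS A\<close>.\<close>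

lemma fgs_seq_error:
  assumes x: "x \<in> carrier_vec n" and eq: "A *\<^sub>v x = b" and v: "v \<in> carrier_vec n"
  shows "fgs_seq A b (x + v) k = x + ((*\<^sub>v) (H_FGS A) ^^ k) v"
proof (induction k)
  case (Suc k)
  define e where "e = ((*\<^sub>v) (H_FGS A) ^^ k) v"
  have e: "e \<in> carrier_vec n"
    unfolding e_def using H_carrier v by (induction k) auto
  have b: "b \<in> carrier_vec n" using eq A x by auto
  have Hx: "H_FGS A *\<^sub>v x \<in> carrier_vec n" and He: "H_FGS A *\<^sub>v e \<in> carrier_vec n"
    and Nb: "N *\<^sub>v b \<in> carrier_vec n"
    using H_carrier N_carrier x e b by auto
  have "fgs_seq A b (x + v) (Suc k) = H_FGS A *\<^sub>v (x + e) + N *\<^sub>v b"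
    using Suc.IH by (simp add: e_def)
  also have "\<dots> = (H_FGS A *\<^sub>v x + N *\<^sub>v b) + H_FGS A *\<^sub>v e"
    unfolding mult_add_distrib_mat_vec[OF H_carrier x e]
    by (rule vec_add_right_commute[OF Hx He Nb])
  also have "\<dots> = x + H_FGS A *\<^sub>v e"
    using solution_fixed[OF x eq] by simp
  finally show ?case by (simp add: e_def)
qed simp

text \<open>If the spectral radius is below 1, the errors decay, and unique solvability follows
  because a kernel vector of \<open>A\<close> would be an eigenvector for 1. Conversely, starting at
  the solution plus an eigenvector makes the error \<open>l ^ k\<close> times that vector, so
  convergence forces \<open>norm l < 1\<close>.\<close>

lemma spectral_radius_less_one_iff_converges:
  assumes b: "b \<in> carrier_vec n"
  shows "spectral_radius (H_FGS A) < 1 \<longleftrightarrow> fgs_converges n A b"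
proof
  assume sr: "spectral_radius (H_FGS A) < 1"
  have "det A \<noteq> 0"
  proof
    assume "det A = 0"
    then obtain v where v: "v \<in> carrier_vec n" "v \<noteq> 0\<^sub>v n" "A *\<^sub>v v = 0\<^sub>v n"
      using det_0_iff_vec_prod_zero_field[OF A] by auto
    have "N *\<^sub>v 0\<^sub>v n = 0\<^sub>v n"
      using N_carrier by (intro eq_vecI) auto
    moreover have "H_FGS A *\<^sub>v v \<in> carrier_vec n" using H_carrier v(1) by auto
    \<comment> \<open>The fixed point equation is applied with right-hand side zero.\<close>
    ultimately have "H_FGS A *\<^sub>v v = 1 \<cdot>\<^sub>v v"
      using solution_fixed[OF v(1,3)] by simp
    then have "eigenvalue (H_FGS A) 1"
      using v H_carrier unfolding eigenvalue_def eigenvector_def by auto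
    with sr show False
      using spectral_radius_less_iff[OF H_carrier n0, of 1] by force
  qed
  note inv = inv_mat_inverse[OF A this]
  define x where "x = inv_mat A *\<^sub>v b"
  have x: "x \<in> carrier_vec n" using inv(1) b by (auto simp: x_def)
  have uniq: "inv_mat A *\<^sub>v b = y \<longleftrightarrow> b = A *\<^sub>v y" if "y \<in> carrier_vec n" for y
    by (rule mult_mat_vec_eq_iff_inverse[OF A inv that b])
  have sol: "A *\<^sub>v x = b" using uniq[OF x] by (simp add: x_def)
  have "vec_tendsto n (fgs_seq A b x0) x" if x0: "x0 \<in> carrier_vec n" for x0
    unfolding vec_tendsto_def
  proof (intro allI impI)
    fix j assume j: "j < n"
    define v where "v = x0 - x"
    have v: "v \<in> carrier_vec n" using x0 x by (auto simp: v_def)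
    have "x0 = x + v" unfolding v_def by (rule vec_add_diff_cancel[OF x x0, symmetric])
    then have seq: "fgs_seq A b x0 k = x + ((*\<^sub>v) (H_FGS A) ^^ k) v" for k
      using fgs_seq_error[OF x sol v] by simp
    have "((*\<^sub>v) (H_FGS A) ^^ k) v \<in> carrier_vec n" for k
      using H_carrier v by (induction k) auto
    then have "fgs_seq A b x0 k $ j = x $ j + (((*\<^sub>v) (H_FGS A) ^^ k) v) $ j" for k
      using j by (metis seq carrier_vecD index_add_vec(1))
    then show "(\<lambda>k. fgs_seq A b x0 k $ j) \<longlonglongrightarrow> x $ j"
      using tendsto_add[OF tendsto_const[of "x $ j"]
          funpow_mult_mat_vec_tendsto_zero[OF H_carrier n0 sr v j]] by simp
  qed
  then show "fgs_converges n A b"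
    unfolding fgs_converges_def using x sol uniq by (metis x_def)
next
  assume "fgs_converges n A b"
  then obtain x where x: "x \<in> carrier_vec n" and sol: "A *\<^sub>v x = b"
    and conv: "\<And>x0. x0 \<in> carrier_vec n \<Longrightarrow> vec_tendsto n (fgs_seq A b x0) x"
    unfolding fgs_converges_def by blast
  have "norm l < 1" if "eigenvalue (H_FGS A) l" for l
  proof -
    from that obtain v where ev: "eigenvector (H_FGS A) v l"
      unfolding eigenvalue_def by blast
    then have v: "v \<in> carrier_vec n" "v \<noteq> 0\<^sub>v n"
      using H_carrier by (auto simp: eigenvector_def)
    then obtain j where j: "j < n" "v $ j \<noteq> 0" by (auto simp: vec_eq_iff)
    have "fgs_seq A b (x + v) k = x + l ^ k \<cdot>\<^sub>v v" for k
      unfolding fgs_seq_error[OF x sol v(1)]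
      using pow_mat_mult_vec_funpow[OF H_carrier v(1)] eigenvector_pow[OF H_carrier ev] by simp
    then have "(\<lambda>k. x $ j + l ^ k * v $ j) \<longlonglongrightarrow> x $ j"
      using conv[of "x + v"] x v(1) j(1) by (simp add: vec_tendsto_def)
    from tendsto_diff[OF this tendsto_const[of "x $ j"]]
    have "(\<lambda>k. l ^ k * v $ j) \<longlonglongrightarrow> 0" by simp
    then show ?thesis using j(2) by (rule norm_less_one_if_scaled_powers_tendsto_zero)
  qed
  then show "spectral_radius (H_FGS A) < 1"
    by (simp add: spectral_radius_less_iff[OF H_carrier n0])
qed

end

section \<open>Row scaling by the diagonal, and ray patterns as phase potentials\<close>

lemma inv_D_part_mult:
  assumes A: "A \<in> carrier_mat n n" and diag: "\<And>i. i < n \<Longrightarrow> A $$ (i, i) \<noteq> 0"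
  shows "inv_mat (D_part A) * A = mat n n (\<lambda>(i, j). A $$ (i, j) / A $$ (i, i))"
    (is "_ = ?B")
proof -
  have D: "D_part A \<in> carrier_mat n n" using A by (simp add: D_part_def)
  have "det (D_part A) = prod_list (diag_mat (D_part A))"
    by (rule det_lower_triangular[OF _ D]) (use A in \<open>simp add: D_part_def mat_diag_def\<close>)
  also have "\<dots> = (\<Prod>i = 0..<n. A $$ (i, i))"
    using A by (auto simp: prod_list_diag_prod D_part_def mat_diag_def intro!: prod.cong)
  finally have "det (D_part A) \<noteq> 0" using diag by simp
  note inv = inv_mat_inverse[OF D this]
  have DB: "D_part A * ?B = A"
    unfolding D_part_def using A diag
    by (subst mat_diag_mult_left[of _ _ n]) (auto intro!: eq_matI)
  have "inv_mat (D_part A) * A = (inv_mat (D_part A) * D_part A) * ?B"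
    unfolding assoc_mult_mat[OF inv(1) D mat_carrier] DB ..
  then show ?thesis by (simp add: inv(3))
qed

text \<open>When angles are built from a potential, the two sides of each ray pattern congruence
  differ by a single full turn.\<close>

lemma rcong_two_piI:
  "b = a \<or> b = a + 2 * pi \<or> b = a - 2 * pi \<Longrightarrow> [a = b] (rmod (2 * pi))"
  unfolding rcong_altdef by (elim disjE) (auto intro: exI[of _ 0] exI[of _ 1] exI[of _ "-1"])

text \<open>A ray pattern is determined by its first column up to \<open>\<psi>\<close>: its angles are potential
  differences \<open>t r - t s\<close>, shifted by \<open>\<pi>\<close>, and by a further \<open>\<psi>\<close> above the diagonal.\<close>

lemma ray_pattern_angles_potential:
  assumes ray: "ray_pattern_angles n \<psi> \<theta>"
  shows "\<exists>t. \<forall>r<n. \<forall>s<n. r \<noteq> s \<longrightarrow>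
    cis (\<theta> r s) = - cis (t r - t s) * (if r < s then cis \<psi> else 1)"
proof -
  \<comment> \<open>Index 0 is treated apart: \<open>\<theta> 0 0 = 0\<close> would give
    \<open>- pi\<close>, but the potential must vanish there for
    \<open>\<theta> r 0 = t r - t 0 + pi\<close> to hold.\<close>
  define t where "t = (\<lambda>r. if r = 0 then 0 else \<theta> r 0 - pi)"
  have sym: "[\<theta> r s + \<theta> s r = \<psi>] (rmod (2 * pi))" if "r < n" "s < n" "r \<noteq> s" for r s
    using ray that by (simp add: ray_pattern_angles_def)
  have tri: "[\<theta> r s - \<theta> r t = \<theta> t s - \<psi> + pi] (rmod (2 * pi))"
    if "t < s" "s < r" "r < n" for r s t
    using ray that by (simp add: ray_pattern_angles_def)
  have low: "[\<theta> r s = t r - t s + pi] (rmod (2 * pi))" if sr: "s < r" "r < n" for r s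
  proof (cases "s = 0")
    case True
    with sr show ?thesis by (auto simp: t_def)
  next
    case False
    \<comment> \<open>Condition (3) for the triple \<open>0 < s < r\<close> expresses the angle
      through column 0 and \<open>\<theta> 0 s\<close>; condition (1) then replaces
      \<open>\<theta> 0 s - \<psi>\<close> by \<open>- \<theta> s 0\<close>.\<close>
    obtain k where k: "\<theta> 0 s - \<psi> + pi = \<theta> r s - \<theta> r 0 + of_int k * (2 * pi)"
      using tri[OF _ sr, of 0] False unfolding rcong_altdef by blast
    obtain m where m: "\<psi> = \<theta> 0 s + \<theta> s 0 + of_int m * (2 * pi)"
      using sym[of 0 s] sr False unfolding rcong_altdef by auto
    have "t r - t s + pi = \<theta> r s + of_int (k + m) * (2 * pi)"
      using k m sr False by (simp add: t_def algebra_simps)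
    then show ?thesis unfolding rcong_altdef by blast
  qed
  have low': "cis (\<theta> r s) = - cis (t r - t s)" if "s < r" "r < n" for r s
    using cis_cong[OF low[OF that]] by (simp flip: cis_mult)
  \<comment> \<open>By condition (1), an angle above the diagonal is \<open>\<psi>\<close> minus its
    mirror image below.\<close>
  have up: "cis (\<theta> r s) = - cis (t r - t s) * cis \<psi>" if "r < s" "s < n" for r s
  proof -
    have "cis (\<theta> r s) * cis (\<theta> s r) = cis \<psi>"
      using sym[of r s] that by (simp add: cis_mult cis_cong)
    then have "- cis (t r - t s) * cis \<psi> = cis (\<theta> r s) * (cis (t r - t s) * cis (t s - t r))"
      by (simp add: low'[OF that] mult_ac flip: \<open>_ = cis \<psi>\<close>)
    then show ?thesis by (simp add: cis_mult)
  qed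
  show ?thesis
    by (rule exI[of _ t]) (use low' up in \<open>auto simp: not_less_iff_gr_or_eq\<close>)
qed

text \<open>The unit diagonal removes the global rotation by \<open>\<eta>\<close>, and a ray
  pattern is a potential up to \<open>\<pi>\<close> and \<open>\<psi>\<close>. Conversely, a
  potential supplies explicit angles, with \<open>\<eta> = 0\<close>.\<close>

lemma U_class_iff_potential:
  assumes B: "B \<in> carrier_mat n n" and diag: "\<And>i. i < n \<Longrightarrow> B $$ (i, i) = 1" and n: "n > 0"
  shows "(\<exists>\<psi>. B \<in> U_class n \<psi>) \<longleftrightarrow>
    (\<exists>t \<psi>. \<forall>r<n. \<forall>s<n. r \<noteq> s \<longrightarrow>
      B $$ (r, s) = - norm (B $$ (r, s)) * cis (t r - t s) * (if r < s then cis \<psi> else 1))"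
proof
  assume "\<exists>\<psi>. B \<in> U_class n \<psi>"
  then obtain \<psi> \<eta> \<theta> where ray: "ray_pattern_angles n \<psi> \<theta>"
    and eq: "\<forall>r<n. \<forall>s<n. B $$ (r, s) = cis \<eta> * of_real (norm (B $$ (r, s)))
      * mat n n (\<lambda>(r, s). cis (\<theta> r s)) $$ (r, s)"
    unfolding U_class_def ray_pattern_mat_def by blast
  have "cis \<eta> = 1"
    using eq[rule_format, OF n n] diag[OF n] ray n by (simp add: ray_pattern_angles_def)
  obtain t where t: "\<And>r s. r < n \<Longrightarrow> s < n \<Longrightarrow> r \<noteq> s \<Longrightarrow>
      cis (\<theta> r s) = - cis (t r - t s) * (if r < s then cis \<psi> else 1)"
    using ray_pattern_angles_potential[OF ray] by blast
  have "B $$ (r, s) = - norm (B $$ (r, s)) * cis (t r - t s) * (if r < s then cis \<psi> else 1)"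
    if rs: "r < n" "s < n" "r \<noteq> s" for r s
    using eq[rule_format, OF rs(1,2)] rs \<open>cis \<eta> = 1\<close> t[OF rs] by (simp add: mult.assoc)
  then show "\<exists>t \<psi>. \<forall>r<n. \<forall>s<n. r \<noteq> s \<longrightarrow>
      B $$ (r, s) = - norm (B $$ (r, s)) * cis (t r - t s) * (if r < s then cis \<psi> else 1)"
    by blast
next
  assume "\<exists>t \<psi>. \<forall>r<n. \<forall>s<n. r \<noteq> s \<longrightarrow>
      B $$ (r, s) = - norm (B $$ (r, s)) * cis (t r - t s) * (if r < s then cis \<psi> else 1)"
  then obtain t \<psi> where t: "\<And>r s. r < n \<Longrightarrow> s < n \<Longrightarrow> r \<noteq> s \<Longrightarrow>
      B $$ (r, s) = - norm (B $$ (r, s)) * cis (t r - t s) * (if r < s then cis \<psi> else 1)"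
    by blast
  \<comment> \<open>The summand \<open>pi\<close> encodes the minus sign; the diagonal angles must
    be exactly 0.\<close>
  define \<theta> where "\<theta> = (\<lambda>r s :: nat. if r = s then 0
    else t r - t s + pi + (if r < s then \<psi> else 0))"
  have "ray_pattern_angles n \<psi> \<theta>"
    unfolding ray_pattern_angles_def
    by (intro conjI allI impI rcong_two_piI; (elim disjE conjE)?; simp add: \<theta>_def)
  moreover have "B $$ (r, s) = cis 0 * of_real (norm (B $$ (r, s))) * cis (\<theta> r s)"
    if rs: "r < n" "s < n" for r s
  proof (cases "r = s")
    case True
    then show ?thesis using diag[OF rs(1)] by (simp add: \<theta>_def)
  next
    case False
    then have "cis (\<theta> r s) = - cis (t r - t s) * (if r < s then cis \<psi> else 1)"
      by (simp add: \<theta>_def flip: cis_mult)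
    with t[OF rs False] show ?thesis by (simp add: mult.assoc split: if_splits)
  qed
  ultimately have "B \<in> U_class n \<psi>"
    unfolding U_class_def ray_pattern_mat_def using B
    by (auto intro!: exI[of _ "0::real"] exI[of _ "mat n n (\<lambda>(r, s). cis (\<theta> r s))"])
  then show "\<exists>\<psi>. B \<in> U_class n \<psi>" ..
qed

section \<open>Eigenvalues of modulus at least 1 and the phases of the matrix\<close>

context fgs_split
begin

text \<open>The eigenvector has entries \<open>cis (t j)\<close>. In each row all off-diagonal terms
  point opposite to the diagonal term, and equipotence makes them cancel it exactly.\<close>

lemma eigenvalue_if_potential:
  assumes DE: "A \<in> DE n"
    and t: "\<And>r s. r < n \<Longrightarrow> s < n \<Longrightarrow> r \<noteq> s \<Longrightarrow>
      A $$ (r, s) / A $$ (r, r) = - norm (A $$ (r, s) / A $$ (r, r)) * cis (t r - t s)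
        * (if r < s then cis \<psi> else 1)"
  shows "eigenvalue (H_FGS A) (cis \<psi>)"
proof -
  define x where "x = vec n (\<lambda>j. cis (t j))"
  have x: "x \<in> carrier_vec n" by (simp add: x_def)
  have "x $ 0 \<noteq> 0" using n0 by (simp add: x_def)
  then have xn0: "x \<noteq> 0\<^sub>v n" using n0 by auto
  have "(\<Sum>j<n. (if j \<le> i then cis \<psi> else 1) * A $$ (i, j) * x $ j) = 0" if i: "i < n" for i
  proof -
    \<comment> \<open>Every term carries the factor \<open>cis \<psi>\<close> exactly once: below
      the diagonal it comes from the weight, above it from the phase of the entry.\<close>
    have term_eq: "(if j \<le> i then cis \<psi> else 1) * A $$ (i, j) * x $ j
        = - (A $$ (i, i) * cis \<psi> * cis (t i)) * norm (A $$ (i, j)) / norm (A $$ (i, i))"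
      if j: "j < n" "j \<noteq> i" for j
    proof -
      have "cis (t i - t j) * cis (t j) = cis (t i)" by (simp add: cis_mult)
      then have cc: "cis (t i - t j) * x $ j = cis (t i)" using j by (simp add: x_def)
      define q where "q = complex_of_real (norm (A $$ (i, j) / A $$ (i, i)))"
      have "A $$ (i, j) = A $$ (i, i) * (- q * cis (t i - t j) * (if i < j then cis \<psi> else 1))"
        using t[OF i j(1)] j(2) diag[OF i] by (simp add: q_def nonzero_divide_eq_eq mult.commute)
      then have "(if j \<le> i then cis \<psi> else 1) * A $$ (i, j) * x $ j
          = - (A $$ (i, i) * q * cis \<psi>) * (cis (t i - t j) * x $ j)"
        using j(2) by (simp add: mult_ac)
      then show ?thesis unfolding cc by (simp add: q_def norm_divide)
    qed
    have "(\<Sum>j<n. (if j \<le> i then cis \<psi> else 1) * A $$ (i, j) * x $ j)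
        = cis \<psi> * A $$ (i, i) * x $ i
          + (\<Sum>j\<in>{..<n} - {i}. (if j \<le> i then cis \<psi> else 1) * A $$ (i, j) * x $ j)"
      using i by (subst sum.remove[of _ i]) auto
    also have "(\<Sum>j\<in>{..<n} - {i}. (if j \<le> i then cis \<psi> else 1) * A $$ (i, j) * x $ j)
        = (\<Sum>j\<in>{..<n} - {i}. - (A $$ (i, i) * cis \<psi> * cis (t i))
            * norm (A $$ (i, j)) / norm (A $$ (i, i)))"
      by (intro sum.cong refl term_eq) auto
    also have "\<dots> = - (A $$ (i, i) * cis \<psi> * cis (t i))
        * (\<Sum>j\<in>{..<n} - {i}. norm (A $$ (i, j))) / norm (A $$ (i, i))"
      by (simp add: sum_distrib_left sum_divide_distrib)
    also have "(\<Sum>j\<in>{..<n} - {i}. norm (A $$ (i, j))) = norm (A $$ (i, i))"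
      using DE i by (simp add: DE_def)
    finally show ?thesis using diag[OF i] i by (simp add: x_def)
  qed
  then have "H_FGS A *\<^sub>v x = cis \<psi> \<cdot>\<^sub>v x" using H_eigen_iff[OF x] by blast
  then show ?thesis
    unfolding eigenvalue_def eigenvector_def using x xn0 H_carrier by auto
qed

text \<open>The potential is read off from the arguments of an eigenvector, and
  \<open>\<psi>\<close> is the argument of the eigenvalue.\<close>

lemma potential_if_eigenvalue:
  assumes irr: "irreducible_mat n A" and DE: "A \<in> DE n"
    and ev: "eigenvalue (H_FGS A) l" and l: "norm l \<ge> 1"
  shows "\<exists>t \<psi>. \<forall>r<n. \<forall>s<n. r \<noteq> s \<longrightarrow>
      A $$ (r, s) / A $$ (r, r) = - norm (A $$ (r, s) / A $$ (r, r)) * cis (t r - t s)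
        * (if r < s then cis \<psi> else 1)"
proof -
  define a where "a = (\<lambda>i j. A $$ (i, j) / A $$ (i, i))"
  have l0: "l \<noteq> 0" using l by auto
  obtain x where x: "x \<in> carrier_vec n" "x \<noteq> 0\<^sub>v n" and "H_FGS A *\<^sub>v x = l \<cdot>\<^sub>v x"
    using ev H_carrier unfolding eigenvalue_def eigenvector_def by auto
  then have row: "(\<Sum>j<n. (if j \<le> i then l else 1) * A $$ (i, j) * x $ j) = 0" if "i < n" for i
    using H_eigen_iff[OF x(1)] that by blast
  define m where "m = Max ((\<lambda>j. norm (x $ j)) ` {..<n})"
  have le: "norm (x $ j) \<le> m" if "j < n" for j
    unfolding m_def using that by (intro Max_ge) auto
  have "m \<in> (\<lambda>j. norm (x $ j)) ` {..<n}"
    unfolding m_def using n0 by (intro Max_in) auto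
  then obtain i0 where i0: "i0 < n" "norm (x $ i0) = m" by auto
  obtain j0 where "j0 < n" "x $ j0 \<noteq> 0" using x by (auto simp: vec_eq_iff)
  then have m0: "m > 0" using le[of j0] by (meson less_le_trans zero_less_norm_iff)
  have aligned: "- (if j \<le> i then l else 1) * a i j * x $ j = norm (a i j) * (l * x $ i)"
    if i: "i < n" "norm (x $ i) = m" and j: "j < n" "j \<noteq> i" for i j
  proof -
    \<comment> \<open>Divided by its diagonal term, the row equation says that the
      \<open>w j\<close> sum to 1, as do the \<open>norm (a i j)\<close> by equipotence. Maximality
      of \<open>norm (x $ i)\<close> and \<open>norm l \<ge> 1\<close> give
      \<open>norm (w j) \<le> norm (a i j)\<close>, so the equality case applies.\<close>
    define w where "w = (\<lambda>j. - (if j \<le> i then l else 1) * a i j * x $ j / (l * x $ i))"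
    have xi: "x $ i \<noteq> 0" using i m0 by auto
    have "w j = of_real (norm (a i j))"
    proof (rule sum_eq_bound_tight[where J = "{..<n} - {i}"])
      fix j assume "j \<in> {..<n} - {i}"
      then have j: "j < n" by simp
      have "norm (if j \<le> i then l else 1) * norm (x $ j) \<le> norm l * norm (x $ i)"
        using l le[OF j] i by (intro mult_mono) auto
      from mult_left_mono[OF this, of "norm (a i j)"]
      show "norm (w j) \<le> norm (a i j)"
        using l0 xi by (simp add: w_def norm_mult norm_divide divide_le_eq mult_ac)
    next
      have "0 = l * A $$ (i, i) * x $ i
          + (\<Sum>j\<in>{..<n} - {i}. (if j \<le> i then l else 1) * A $$ (i, j) * x $ j)"
        using row[OF i(1)] i(1) by (subst (asm) sum.remove[of _ i]) auto
      also have "(\<Sum>j\<in>{..<n} - {i}. (if j \<le> i then l else 1) * A $$ (i, j) * x $ j)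
          = (\<Sum>j\<in>{..<n} - {i}. - (l * A $$ (i, i) * x $ i) * w j)"
        by (rule sum.cong) (use l0 xi diag[OF i(1)] in \<open>auto simp: w_def a_def field_simps\<close>)
      also have "\<dots> = - (l * A $$ (i, i) * x $ i) * (\<Sum>j\<in>{..<n} - {i}. w j)"
        by (simp add: sum_distrib_left)
      finally have "l * A $$ (i, i) * x $ i * (1 - (\<Sum>j\<in>{..<n} - {i}. w j)) = 0"
        by (simp add: algebra_simps)
      then have "(\<Sum>j\<in>{..<n} - {i}. w j) = 1"
        using l0 xi diag[OF i(1)] by simp
      moreover have "(\<Sum>j\<in>{..<n} - {i}. norm (A $$ (i, j))) = norm (A $$ (i, i))"
        using DE i(1) by (simp add: DE_def)
      then have "(\<Sum>j\<in>{..<n} - {i}. norm (a i j)) = 1"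
        using diag[OF i(1)] by (simp add: a_def norm_divide flip: sum_divide_distrib)
      ultimately show "(\<Sum>j\<in>{..<n} - {i}. w j) = of_real (\<Sum>j\<in>{..<n} - {i}. norm (a i j))"
        by simp
    qed (use j in auto)
    moreover have "- (if j \<le> i then l else 1) * a i j * x $ j = w j * (l * x $ i)"
      using l0 xi by (simp add: w_def)
    ultimately show ?thesis by simp
  qed
  \<comment> \<open>Taking norms in \<open>aligned\<close>: below the diagonal \<open>norm l\<close>
    cancels; above it \<open>norm (x $ j) = norm l * m\<close>, which is at most \<open>m\<close>
    only if \<open>norm l = 1\<close>.\<close>
  have moduli: "norm (x $ j) = m \<and> (i < j \<longrightarrow> norm l = 1)"
    if i: "i < n" "norm (x $ i) = m" and j: "j < n" "j \<noteq> i" and nz: "A $$ (i, j) \<noteq> 0" for i j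
  proof -
    have "a i j \<noteq> 0" using nz diag[OF i(1)] by (simp add: a_def)
    then have eq: "norm (if j \<le> i then l else 1) * norm (x $ j) = norm l * m"
      using arg_cong[OF aligned[OF i j], of norm] i(2) by (simp add: norm_mult)
    show ?thesis
    proof (cases "j \<le> i")
      case True
      then show ?thesis using eq l0 by simp
    next
      case False
      then have "norm l * m \<le> 1 * m" using eq le[OF j(1)] by simp
      then have "norm l = 1" using m0 l by (simp add: mult_le_cancel_right)
      then show ?thesis using eq False by simp
    qed
  qed
  have "{i \<in> {..<n}. norm (x $ i) = m} = {..<n}"
  proof (rule irreducible_closed_set_full[OF irr])
    fix i j assume "i \<in> {i \<in> {..<n}. norm (x $ i) = m}" "j < n"
      and j: "j \<notin> {i \<in> {..<n}. norm (x $ i) = m}"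
    then show "A $$ (i, j) = 0"
      using moduli[of i j] by blast
  qed (use i0 in auto)
  then have all: "norm (x $ i) = m" if "i < n" for i using that by blast
  \<comment> \<open>Row 0 has all its off-diagonal entries above the diagonal, so a nonzero one
    among them forces \<open>norm l = 1\<close>.\<close>
  have "\<exists>j\<in>{..<n} - {0}. norm (A $$ (0, j)) \<noteq> 0"
  proof (rule ccontr)
    assume "\<not> ?thesis"
    then have "(\<Sum>j\<in>{..<n} - {0}. norm (A $$ (0, j))) = 0" by (intro sum.neutral) auto
    then show False using DE n0 diag[OF n0] by (auto simp: DE_def)
  qed
  then have l1: "norm l = 1" using moduli[OF n0 all[OF n0]] by auto
  define t where "t = (\<lambda>i. Arg (x $ i))"
  have xt: "x $ i = m * cis (t i)" if "i < n" for i
    using rcis_cmod_Arg[of "x $ i"] all[OF that] by (simp add: rcis_def t_def)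
  have lc: "l = cis (Arg l)" using rcis_cmod_Arg[of l] l1 by (simp add: rcis_def)
  have "a r s = - norm (a r s) * cis (t r - t s) * (if r < s then cis (Arg l) else 1)"
    if rs: "r < n" "s < n" "r \<noteq> s" for r s
  proof -
    have "m * (- (if s \<le> r then l else 1) * a r s * cis (t s))
        = m * (norm (a r s) * (l * cis (t r)))"
      using aligned[OF rs(1) all[OF rs(1)] rs(2)] rs xt by (simp add: mult_ac)
    then have "- (if s \<le> r then l else 1) * a r s * cis (t s) = norm (a r s) * (l * cis (t r))"
      using m0 by (subst (asm) mult_left_cancel) auto
    \<comment> \<open>The product of the two conditional factors on the right is \<open>l\<close>
      whichever side of the diagonal \<open>(r, s)\<close> lies on, so the common nonzero factor can
      be cancelled.\<close>
    then have "- (if s \<le> r then l else 1) * (a r s * cis (t s)) =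
        - (if s \<le> r then l else 1) * (- norm (a r s) * cis (t r) * (if r < s then l else 1))"
      using rs(3) by (simp add: mult_ac)
    then have "a r s * cis (t s) = - norm (a r s) * cis (t r) * (if r < s then l else 1)"
      using l0 by (subst (asm) mult_left_cancel) auto
    then show ?thesis
      unfolding lc[symmetric] cis_divide[symmetric] by (simp add: field_simps)
  qed
  then show ?thesis unfolding a_def by blast
qed

end

theorem theorem4p9:
  fixes n :: nat and A :: "complex mat"
  assumes "n \<ge> 3"
    and "A \<in> carrier_mat n n"
    and "irreducible_mat n A"
    and "A \<in> DE n"
  shows "(spectral_radius (H_FGS A) < 1 \<longleftrightarrow> (\<forall>\<psi>::real. inv_mat (D_part A) * A \<notin> U_class n \<psi>))
    \<and> (\<forall>b\<in>carrier_vec n. spectral_radius (H_FGS A) < 1 \<longleftrightarrow> fgs_converges n A b)"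
proof -
  have diag: "A $$ (i, i) \<noteq> 0" if "i < n" for i
    using irreducible_DE_diag_nonzero[OF _ assms(3,4) that] assms(1) by simp
  interpret fgs_split n A
    by unfold_locales (use assms(1,2) diag in auto)
  define B where "B = inv_mat (D_part A) * A"
  have B_eq: "B = mat n n (\<lambda>(i, j). A $$ (i, j) / A $$ (i, i))"
    unfolding B_def by (rule inv_D_part_mult[OF A diag])
  have U_iff: "(\<exists>\<psi>. B \<in> U_class n \<psi>) \<longleftrightarrow>
    (\<exists>t \<psi>. \<forall>r<n. \<forall>s<n. r \<noteq> s \<longrightarrow>
      A $$ (r, s) / A $$ (r, r) = - norm (A $$ (r, s) / A $$ (r, r)) * cis (t r - t s)
        * (if r < s then cis \<psi> else 1))"
    using U_class_iff_potential[of B n] n0 diag by (simp add: B_eq)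
  \<comment> \<open>Both properties are compared with the phase condition in \<open>U_iff\<close>;
    negating them gives the claim about the spectral radius.\<close>
  have "(\<exists>\<psi>. B \<in> U_class n \<psi>) \<longleftrightarrow> (\<exists>l. eigenvalue (H_FGS A) l \<and> norm l \<ge> 1)"
  proof
    assume "\<exists>\<psi>. B \<in> U_class n \<psi>"
    then obtain t \<psi> where "\<And>r s. r < n \<Longrightarrow> s < n \<Longrightarrow> r \<noteq> s \<Longrightarrow>
      A $$ (r, s) / A $$ (r, r) = - norm (A $$ (r, s) / A $$ (r, r)) * cis (t r - t s)
        * (if r < s then cis \<psi> else 1)"
      unfolding U_iff by blast
    from eigenvalue_if_potential[OF assms(4) this]
    show "\<exists>l. eigenvalue (H_FGS A) l \<and> norm l \<ge> 1"
      by (intro exI[of _ "cis \<psi>"]) simp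
  next
    assume "\<exists>l. eigenvalue (H_FGS A) l \<and> norm l \<ge> 1"
    then show "\<exists>\<psi>. B \<in> U_class n \<psi>"
      unfolding U_iff using potential_if_eigenvalue[OF assms(3,4)] by blast
  qed
  then have "spectral_radius (H_FGS A) < 1 \<longleftrightarrow> (\<forall>\<psi>. B \<notin> U_class n \<psi>)"
    unfolding spectral_radius_less_iff[OF H_carrier n0] by (meson not_le)
  then show ?thesis
    using spectral_radius_less_one_iff_converges by (simp add: B_def)
qed

end
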